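(* Let $a,b>0$ be real numbers, let $L=[l_{ij}]$ be an $n\times n$ generalized Laplacian matrix, and let $D=[d_{ij}]$ be the matrix with $d_{ij}=a^2 l_{ii}+b^2 l_{jj}-2ab\,l_{ij}$ for all $i,j$. Assume $D\neq 0$. If $D$ is a circum generalized Euclidean distance matrix, then $$D^{\dagger}=-\frac{1}{2ab}L^{\dagger}+\frac{1}{\mathbf{1}'D^{\dagger}\mathbf{1}}\,(D^{\dagger}\mathbf{1})(\mathbf{1}'D^{\dagger}).$$
   Context: All matrices are real; a prime denotes transpose. $\mathbf{1}\in\mathbb{R}^n$ is the vector of all ones. $A^\dagger$ denotes the Moore-Penrose inverse of $A$. An $n\times n$ real symmetric matrix $L$ is a generalized Laplacian matrix if $L$ is positive semidefinite and $L\mathbf{1}=0$. Vectors $p^1,\dots,p^n$ in a Euclidean space $V$ lie on the surface of a hypersphere if there exist $v\in V$ and $r>0$ such that $\|p^i-v\|^2=r$ for all $i$. A matrix $D=[d_{ij}]$ is a circum generalized Euclidean distance matrix if there exist real numbers $\alpha,\beta>0$ and vectors $x^1,\dots,x^n$ in a Euclidean space, lying on the surface of a hypersphere and with $\sum_{i=1}^n x^i=0$, such that $d_{ij}=\|\alpha x^i-\beta x^j\|^2$ for all $i,j$. *)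

theory Defs
  imports "HOL-Analysis.Analysis"
begin

text \<open>In \<^typ>\<open>real^'n\<close> the constant \<open>1\<close> is the vector all of whose components are 1.\<close>

definition is_moore_penrose_inverse :: "real^'n^'m \<Rightarrow> real^'m^'n \<Rightarrow> bool" where
  "is_moore_penrose_inverse A X \<longleftrightarrow>
     A ** X ** A = A \<and> X ** A ** X = X \<and>
     transpose (A ** X) = A ** X \<and> transpose (X ** A) = X ** A"

lemma is_moore_penrose_inverse_unique:
  assumes "is_moore_penrose_inverse A X" "is_moore_penrose_inverse A Y"
  shows "X = Y"
proof -
  have X: "A ** X ** A = A" "X ** A ** X = X"
      "transpose (A ** X) = A ** X" "transpose (X ** A) = X ** A"
    and Y: "A ** Y ** A = A" "Y ** A ** Y = Y"
      "transpose (A ** Y) = A ** Y" "transpose (Y ** A) = Y ** A"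
    using assms by (auto simp: is_moore_penrose_inverse_def)
  have "A ** X = transpose (A ** Y ** (A ** X))"
    using X Y by (metis matrix_mul_assoc)
  then have 1: "A ** X = A ** Y"
    using X Y by (metis matrix_transpose_mul matrix_mul_assoc)
  have "X ** A = transpose (X ** A ** (Y ** A))"
    using X Y by (metis matrix_mul_assoc)
  then have 2: "X ** A = Y ** A"
    using X Y by (metis matrix_transpose_mul matrix_mul_assoc)
  show ?thesis
    using X(2) Y(2) 1 2 by (metis matrix_mul_assoc)
qed

lemma is_moore_penrose_inverse_exists:
  fixes A :: "real^'n^'m"
  shows "\<exists>X. is_moore_penrose_inverse A X"
proof -
  have decomp: "\<exists>x w. y = B *v x + w \<and> transpose B *v w = 0" for B :: "real^'p^'q" and y
  proof -
    obtain u w where uw: "u \<in> span (range ((*v) B))"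
        "\<And>v. v \<in> span (range ((*v) B)) \<Longrightarrow> orthogonal w v" "y = u + w"
      using orthogonal_subspace_decomp_exists by metis
    have "span (range ((*v) B)) = range ((*v) B)"
      by (simp add: linear_subspace_image span_eq_iff)
    then obtain x where "u = B *v x" using uw(1) by (metis imageE)
    moreover have "(transpose B *v w) \<bullet> (transpose B *v w) = 0"
      using uw(2) by (metis dot_lmul_matrix orthogonal_def rangeI span_base transpose_matrix_vector)
    ultimately show ?thesis using uw(3) by auto
  qed
  have "\<exists>c. transpose A *v (A *v (transpose A *v c)) = transpose A *v y" for y
    using decomp[of y A] decomp[of _ "transpose A"]
    by (metis add.right_neutral matrix_vector_right_distrib transpose_transpose)
  then obtain c where c: "\<And>y. transpose A *v (A *v (transpose A *v c y)) = transpose A *v y"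
    by metis
  define C where "C = (\<chi> i j. c (axis j 1) $ i)"
  define X where "X = transpose A ** C"
  have "C *v axis j 1 = c (axis j 1)" for j
    by (simp add: C_def matrix_vector_mult_basis column_def vec_eq_iff)
  then have "(transpose A ** A ** X) *v axis j 1 = transpose A *v axis j 1" for j
    using c by (simp add: X_def matrix_vector_mul_assoc[symmetric])
  then have AAX: "transpose A ** (A ** X) = transpose A"
    by (simp add: matrix_vector_mult_basis column_def vec_eq_iff matrix_mul_assoc)
  have sym1: "transpose (A ** X) = A ** X"
    using AAX by (metis matrix_mul_assoc matrix_transpose_mul transpose_transpose)
  have AXA: "A ** X ** A = A"
    using AAX sym1 by (metis matrix_transpose_mul transpose_transpose)
  have "transpose (X ** A) ** X = X"
    using AXA unfolding X_def
    by (metis matrix_mul_assoc matrix_transpose_mul transpose_transpose)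
  then have sym2: "transpose (X ** A) = X ** A"
    by (metis matrix_mul_assoc matrix_transpose_mul transpose_transpose)
  then have "X ** A ** X = X"
    using \<open>transpose (X ** A) ** X = X\<close> by simp
  with sym1 sym2 AXA show ?thesis
    unfolding is_moore_penrose_inverse_def by blast
qed

definition moore_penrose_inverse :: "real^'n^'m \<Rightarrow> real^'m^'n" where
  "moore_penrose_inverse A = (THE X. is_moore_penrose_inverse A X)"

lemma is_moore_penrose_inverse_moore_penrose_inverse:
  "is_moore_penrose_inverse A (moore_penrose_inverse A)"
  unfolding moore_penrose_inverse_def
  by (rule theI') (use is_moore_penrose_inverse_exists is_moore_penrose_inverse_unique in blast)

definition positive_semidefinite :: "real^'n^'n \<Rightarrow> bool" where
  "positive_semidefinite A \<longleftrightarrow> transpose A = A \<and> (\<forall>x. 0 \<le> x \<bullet> (A *v x))"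

definition generalized_laplacian :: "real^'n^'n \<Rightarrow> bool" where
  "generalized_laplacian L \<longleftrightarrow> positive_semidefinite L \<and> L *v 1 = 0"

text \<open>Here \<open>r\<close> is the square of the radius.\<close>

definition on_hypersphere :: "('n \<Rightarrow> 'v::euclidean_space) \<Rightarrow> bool" where
  "on_hypersphere p \<longleftrightarrow> (\<exists>v. \<exists>r>0. \<forall>i. (norm (p i - v))\<^sup>2 = r)"

text \<open>
  The existential quantifier over the ambient Euclidean space cannot be expressed inside a
  formula, so the space is passed as a type argument. A theorem that assumes
  \<open>circum_gedm TYPE('v) D\<close> for a type variable \<open>'v\<close> covers every Euclidean space.
\<close>

definition circum_gedm :: "'v::euclidean_space itself \<Rightarrow> real^'n^'n \<Rightarrow> bool" where
  "circum_gedm _ D \<longleftrightarrow>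
     (\<exists>\<alpha> \<beta>. \<exists>x :: 'n \<Rightarrow> 'v. \<alpha> > 0 \<and> \<beta> > 0 \<and> on_hypersphere x \<and> (\<Sum>i\<in>UNIV. x i) = 0 \<and>
        (\<forall>i j. D $ i $ j = (norm (\<alpha> *\<^sub>R x i - \<beta> *\<^sub>R x j))\<^sup>2))"

definition outer_product :: "real^'m \<Rightarrow> real^'n \<Rightarrow> real^'n^'m" where
  "outer_product u v = (\<chi> i j. u $ i * v $ j)"

end

theory Submission
  imports Defs
begin

text \<open>
  Double centring shows that the Gram matrix of the hypersphere configuration is a positive
  multiple of \<open>L\<close>. The centre of the sphere then yields \<open>z\<close> and \<open>c > 0\<close> such that the diagonal
  \<open>l\<close> of \<open>L\<close> satisfies \<open>l = L z + c 1\<close>, where \<open>z\<close> may be chosen in the range of \<open>L\<close>. Consequently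
  \<open>u = (2/n) 1 + (a/b) z\<close> and \<open>w = (2/n) 1 + (b/a) z\<close> satisfy \<open>D u = m 1\<close> and \<open>w' D = m 1'\<close> with
  \<open>m > 0\<close>, so that \<open>X = -L\<^sup>\<dagger>/(2ab) + u w'/(2m)\<close> has \<open>D X = X D = L L\<^sup>\<dagger> + 1 1'/n\<close>, the orthogonal
  projection onto the span of \<open>1\<close> and the range of \<open>L\<close>. Hence \<open>X = D\<^sup>\<dagger>\<close>, and \<open>X 1 = u/m\<close>,
  \<open>1' X = w'/m\<close>, \<open>1' X 1 = 2/m\<close>.
\<close>

section \<open>Algebra of rank-one matrices\<close>

lemma outer_product_add_left: "outer_product (u + u') v = outer_product u v + outer_product u' v"
  and outer_product_add_right: "outer_product u (v + v') = outer_product u v + outer_product u v'"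
  and outer_product_scaleR_left: "outer_product (k *\<^sub>R u) v = k *\<^sub>R outer_product u v"
  and outer_product_scaleR_right: "outer_product u (k *\<^sub>R v) = k *\<^sub>R outer_product u v"
  and outer_product_zero_right: "outer_product u 0 = 0"
  and outer_product_zero_left: "outer_product 0 v = 0"
  by (simp_all add: outer_product_def vec_eq_iff algebra_simps)

lemma transpose_outer_product: "transpose (outer_product u v) = outer_product v u"
  by (simp add: outer_product_def transpose_def vec_eq_iff)

lemma outer_product_vector_mult: "outer_product u v *v w = (v \<bullet> w) *\<^sub>R u"
  by (simp add: outer_product_def matrix_vector_mult_def vec_eq_iff inner_vec_def
      sum_distrib_right sum_distrib_left mult_ac)

lemma vector_mult_outer_product: "w v* outer_product u v = (w \<bullet> u) *\<^sub>R v"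
  by (simp add: outer_product_def vector_matrix_mult_def vec_eq_iff inner_vec_def
      sum_distrib_right sum_distrib_left mult_ac)

lemma matrix_mult_outer_product: "A ** outer_product u v = outer_product (A *v u) v"
  by (simp add: outer_product_def matrix_matrix_mult_def matrix_vector_mult_def vec_eq_iff
      sum_distrib_right sum_distrib_left mult_ac)

lemma outer_product_matrix_mult: "outer_product u v ** A = outer_product u (v v* A)"
  by (simp add: outer_product_def matrix_matrix_mult_def vector_matrix_mult_def vec_eq_iff
      sum_distrib_right sum_distrib_left mult_ac)

lemma matrix_mult_scaleR: "A ** (k *\<^sub>R B) = k *\<^sub>R (A ** B)" for A :: "real^'n^'m"
  by (simp only: matrix_scalar_ac scalar_matrix_assoc)

lemma matrix_mult_add_rdistrib: "(A + B) ** C = A ** C + B ** C" for A :: "real^'n^'m"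
  by (simp add: matrix_matrix_mult_def vec_eq_iff distrib_right sum.distrib)

lemma transpose_add: "transpose (A + B) = transpose A + transpose B" for A :: "real^'n^'m"
  by (simp add: transpose_def vec_eq_iff)

section \<open>Moore-Penrose inverses of symmetric matrices\<close>

lemma moore_penrose_inverse_eqI:
  "is_moore_penrose_inverse A X \<Longrightarrow> moore_penrose_inverse A = X"
  using is_moore_penrose_inverse_unique is_moore_penrose_inverse_moore_penrose_inverse by blast

lemma moore_penrose_inverse_transpose:
  "moore_penrose_inverse (transpose A) = transpose (moore_penrose_inverse A)"
proof (rule moore_penrose_inverse_eqI)
  let ?X = "moore_penrose_inverse A"
  have X: "A ** ?X ** A = A" "?X ** A ** ?X = ?X"
    "transpose (A ** ?X) = A ** ?X" "transpose (?X ** A) = ?X ** A"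
    using is_moore_penrose_inverse_moore_penrose_inverse[of A]
    by (auto simp: is_moore_penrose_inverse_def)
  show "is_moore_penrose_inverse (transpose A) (transpose ?X)"
    unfolding is_moore_penrose_inverse_def
    using X by (metis matrix_transpose_mul matrix_mul_assoc)
qed

lemma symmetric_moore_penrose_inverse:
  assumes "transpose A = A"
  shows "transpose (moore_penrose_inverse A) = moore_penrose_inverse A"
    and "moore_penrose_inverse A ** A = A ** moore_penrose_inverse A"
proof -
  show *: "transpose (moore_penrose_inverse A) = moore_penrose_inverse A"
    using moore_penrose_inverse_transpose[of A] assms by simp
  show "moore_penrose_inverse A ** A = A ** moore_penrose_inverse A"
    using is_moore_penrose_inverse_moore_penrose_inverse[of A] * assms
    unfolding is_moore_penrose_inverse_def by (metis matrix_transpose_mul)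
qed

text \<open>Since the inverse \<open>?P\<close> commutes with \<open>A\<close>, the identity
  \<open>?P = ?P ** A ** ?P\<close> becomes \<open>?P = ?P ** ?P ** A\<close>.\<close>

lemma symmetric_moore_penrose_inverse_null:
  assumes "transpose A = A" "A *v x = 0"
  shows "moore_penrose_inverse A *v x = 0"
proof -
  let ?P = "moore_penrose_inverse A"
  have "?P *v x = (?P ** A ** ?P) *v x"
    using is_moore_penrose_inverse_moore_penrose_inverse[of A]
    by (simp add: is_moore_penrose_inverse_def)
  also have "\<dots> = ?P *v (?P *v (A *v x))"
    using symmetric_moore_penrose_inverse[OF assms(1)]
    by (metis matrix_mul_assoc matrix_vector_mul_assoc)
  finally show ?thesis using assms(2) by simp
qed

text \<open>The residual \<open>e\<close> lies in the kernel of \<open>A\<close>. By symmetry it is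
  orthogonal to the range of \<open>A\<close>, and by assumption to \<open>h\<close>, hence to
  itself.\<close>

lemma symmetric_range_if_orthogonal_null:
  fixes h :: "real^'n"
  assumes "transpose A = A" and orth: "\<And>e. A *v e = 0 \<Longrightarrow> e \<bullet> h = 0"
  shows "A *v (moore_penrose_inverse A *v h) = h"
proof -
  let ?P = "moore_penrose_inverse A"
  define e where "e = h - A *v (?P *v h)"
  have "A *v (A *v (?P *v h)) = A *v (?P *v (A *v h))"
    using symmetric_moore_penrose_inverse(2)[OF assms(1)]
    by (metis matrix_vector_mul_assoc)
  also have "\<dots> = A *v h"
    using is_moore_penrose_inverse_moore_penrose_inverse[of A]
    by (simp add: is_moore_penrose_inverse_def matrix_vector_mul_assoc matrix_mul_assoc)
  finally have Ae: "A *v e = 0"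
    by (simp add: e_def matrix_vector_mult_diff_distrib)
  have "e \<bullet> (A *v (?P *v h)) = (A *v e) \<bullet> (?P *v h)"
    by (metis assms(1) dot_lmul_matrix transpose_matrix_vector)
  then have "e \<bullet> e = 0"
    using Ae orth[OF Ae] by (simp add: e_def inner_diff_right inner_diff_left)
  then show ?thesis by (simp add: e_def)
qed

section \<open>The explicit inverse of \<open>D\<close>\<close>

text \<open>The sphere enters only through the equation for \<open>l\<close>. Normalising
  \<open>1 \<bullet> u = 2\<close>, the vector \<open>D *v u\<close> is a multiple of
  \<open>1\<close> as soon as \<open>L *v u = (a / b) *\<^sub>R (L *v z)\<close>, which dictates
  \<open>u\<close>. Transposing \<open>D\<close> swaps \<open>a\<close> and \<open>b\<close>, which
  gives \<open>w\<close> with the same \<open>m\<close>.\<close>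

lemma moore_penrose_inverse_circum:
  fixes a b c m :: real and L :: "real^'n^'n" and l z :: "real^'n"
  defines "n \<equiv> real CARD('n)"
  defines "u \<equiv> (2 / n) *\<^sub>R 1 + (a / b) *\<^sub>R z" and "w \<equiv> (2 / n) *\<^sub>R 1 + (b / a) *\<^sub>R z"
  assumes ab: "a > 0" "b > 0" and symL: "transpose L = L" and L1: "L *v 1 = 0"
    and z: "z = moore_penrose_inverse L *v l" and l: "l = L *v z + c *\<^sub>R 1"
    and D: "D = a\<^sup>2 *\<^sub>R outer_product l 1 + b\<^sup>2 *\<^sub>R outer_product 1 l + (- 2 * a * b) *\<^sub>R L"
    and m: "m = 2 * (a\<^sup>2 + b\<^sup>2) * c + a * b * (z \<bullet> (L *v z))" "m \<noteq> 0"
  shows "moore_penrose_inverse D =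
      (- (1 / (2 * a * b))) *\<^sub>R moore_penrose_inverse L + (1 / (2 * m)) *\<^sub>R outer_product u w"
    and "moore_penrose_inverse D *v 1 = (1 / m) *\<^sub>R u"
    and "1 v* moore_penrose_inverse D = (1 / m) *\<^sub>R w"
    and "1 \<bullet> (moore_penrose_inverse D *v 1) = 2 / m"
proof -
  let ?P = "moore_penrose_inverse L"
  have n: "n > 0" by (simp add: n_def)
  have one: "(1::real^'n) \<bullet> 1 = n"
    by (simp add: inner_vec_def n_def)
  have P: "transpose ?P = ?P" "?P ** L = L ** ?P" "?P *v 1 = 0"
    using symmetric_moore_penrose_inverse[OF symL]
      symmetric_moore_penrose_inverse_null[OF symL L1] by auto
  have mp: "L ** ?P ** L = L" "?P ** L ** ?P = ?P" "transpose (L ** ?P) = L ** ?P"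
    using is_moore_penrose_inverse_moore_penrose_inverse[of L]
    by (auto simp: is_moore_penrose_inverse_def)
  have vL: "x v* L = L *v x" and vP: "x v* ?P = ?P *v x" for x
    by (metis symL transpose_matrix_vector, metis P(1) transpose_matrix_vector)
  \<comment> \<open>Apply \<open>?P\<close> to the equation for \<open>l\<close>: the term in
    \<open>1\<close> dies and the left side is \<open>z\<close>, so \<open>z\<close> lies in the
    range of \<open>L\<close>.\<close>
  have PLz: "?P *v (L *v z) = z"
    using z l P(3)
    by (metis add.right_neutral matrix_vector_mult_scaleR matrix_vector_right_distrib scaleR_zero_right)
  have LPz: "L *v (?P *v z) = z"
    using PLz P(2) by (simp add: matrix_vector_mul_assoc)
  have oneL: "1 \<bullet> (L *v x) = 0" and oneP: "1 \<bullet> (?P *v x) = 0" for x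
    by (metis L1 dot_lmul_matrix inner_zero_left vL, metis P(3) dot_lmul_matrix inner_zero_left vP)
  have z1: "1 \<bullet> z = 0" "z \<bullet> 1 = 0"
    by (metis LPz oneL, metis LPz oneL inner_commute)
  have Pl: "?P *v l = z" using z by simp
  have l1: "1 \<bullet> l = n * c" "l \<bullet> 1 = n * c"
    using oneL one by (auto simp: l inner_add_right inner_add_left inner_commute)
  have lz: "l \<bullet> z = z \<bullet> (L *v z)"
    using z1 by (subst l) (simp add: inner_add_left inner_commute[of "L *v z"])
  have Du: "D *v u = m *\<^sub>R 1"
  proof -
    have "D *v u = (2 * a\<^sup>2) *\<^sub>R l
        + (2 * b\<^sup>2 * c + a * b * (z \<bullet> (L *v z))) *\<^sub>R 1 + (- 2 * a\<^sup>2) *\<^sub>R (L *v z)"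
      using ab n L1 one z1 l1 lz
      by (simp add: D u_def matrix_vector_mult_add_rdistrib matrix_vector_right_distrib
          outer_product_vector_mult scaleR_matrix_vector_assoc[symmetric]
          matrix_vector_mult_scaleR inner_add_right algebra_simps power2_eq_square)
    also have "\<dots> = m *\<^sub>R 1"
      unfolding m(1) by (subst l) (simp add: algebra_simps)
    finally show ?thesis .
  qed
  have wD: "w v* D = m *\<^sub>R 1"
  proof -
    have "transpose D = a\<^sup>2 *\<^sub>R outer_product 1 l + b\<^sup>2 *\<^sub>R outer_product l 1 + (- 2 * a * b) *\<^sub>R L"
      unfolding D by (simp only: transpose_add transpose_scalar transpose_outer_product symL)
    then have "w v* D = (a\<^sup>2 *\<^sub>R outer_product 1 l + b\<^sup>2 *\<^sub>R outer_product l 1 + (- 2 * a * b) *\<^sub>R L) *v w"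
      by (metis transpose_matrix_vector)
    also have "\<dots> = (2 * b\<^sup>2) *\<^sub>R l
        + (2 * a\<^sup>2 * c + a * b * (z \<bullet> (L *v z))) *\<^sub>R 1 + (- 2 * b\<^sup>2) *\<^sub>R (L *v z)"
      using ab n L1 one z1 l1 lz
      by (simp add: w_def matrix_vector_mult_add_rdistrib matrix_vector_right_distrib
          outer_product_vector_mult scaleR_matrix_vector_assoc[symmetric]
          matrix_vector_mult_scaleR inner_add_right algebra_simps power2_eq_square)
    also have "\<dots> = m *\<^sub>R 1"
      unfolding m(1) by (subst l) (simp add: algebra_simps)
    finally show ?thesis .
  qed
  define X where "X = (- (1 / (2 * a * b))) *\<^sub>R ?P + (1 / (2 * m)) *\<^sub>R outer_product u w"
  define E where "E = L ** ?P + (1 / n) *\<^sub>R outer_product 1 1"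
  \<comment> \<open>As \<open>?P\<close> kills \<open>1\<close>, one rank-one term of
    \<open>D\<close> drops out of each product. The surviving one is cancelled in
    \<open>D ** X\<close> by the \<open>z\<close> part of \<open>w\<close>, and in
    \<open>X ** D\<close> by that of \<open>u\<close>.\<close>
  have DP: "D ** ?P = b\<^sup>2 *\<^sub>R outer_product 1 z + (- 2 * a * b) *\<^sub>R (L ** ?P)"
    by (simp add: D matrix_mult_add_rdistrib scalar_matrix_assoc[symmetric] outer_product_matrix_mult vP P(3) Pl
        outer_product_zero_right del: scaleR_minus_left)
  have PD: "?P ** D = a\<^sup>2 *\<^sub>R outer_product z 1 + (- 2 * a * b) *\<^sub>R (L ** ?P)"
    by (simp add: D matrix_add_ldistrib matrix_mult_scaleR matrix_mult_outer_product P Pl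
        outer_product_zero_left del: scaleR_minus_left)
  have DX: "D ** X = E"
  proof -
    have "D ** X = (- (1 / (2 * a * b))) *\<^sub>R (D ** ?P) + (1 / (2 * m)) *\<^sub>R outer_product (m *\<^sub>R 1) w"
      by (simp add: X_def matrix_add_ldistrib matrix_mult_scaleR matrix_mult_outer_product Du
          del: scaleR_minus_left)
    also have "\<dots> = E"
      using ab n m(2)
      by (simp add: DP E_def w_def outer_product_scaleR_left outer_product_add_right
          outer_product_scaleR_right scaleR_add_right vec_eq_iff field_simps power2_eq_square)
    finally show ?thesis .
  qed
  have XD: "X ** D = E"
  proof -
    have "X ** D = (- (1 / (2 * a * b))) *\<^sub>R (?P ** D) + (1 / (2 * m)) *\<^sub>R outer_product u (m *\<^sub>R 1)"
      by (simp add: X_def matrix_mult_add_rdistrib scalar_matrix_assoc[symmetric] outer_product_matrix_mult wD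
          del: scaleR_minus_left)
    also have "\<dots> = E"
      using ab n m(2)
      by (simp add: PD E_def u_def outer_product_scaleR_left outer_product_add_left
          outer_product_scaleR_right scaleR_add_right vec_eq_iff field_simps power2_eq_square)
    finally show ?thesis .
  qed
  \<comment> \<open>\<open>E\<close> fixes \<open>1\<close>, \<open>z\<close>, \<open>l\<close> and
    the columns of \<open>L\<close> and \<open>?P\<close>, hence those of \<open>D\<close> and
    \<open>X\<close>. With \<open>D ** X = X ** D = E\<close> this gives the first two Penrose
    equations; symmetry of \<open>E\<close> gives the others.\<close>
  have E1: "E *v 1 = 1"
    using n by (simp add: E_def matrix_vector_mult_add_rdistrib outer_product_vector_mult one
        scaleR_matrix_vector_assoc[symmetric] matrix_vector_mul_assoc[symmetric] P(3))
  have Ez: "E *v z = z"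
    by (simp add: E_def matrix_vector_mult_add_rdistrib outer_product_vector_mult z1
        scaleR_matrix_vector_assoc[symmetric] matrix_vector_mul_assoc[symmetric] LPz)
  have EL: "E ** L = L"
    by (simp add: E_def matrix_mult_add_rdistrib scalar_matrix_assoc[symmetric] mp outer_product_matrix_mult vL L1
        outer_product_zero_right)
  have El: "E *v l = l"
    using EL E1 by (subst (1 2) l)
      (simp add: matrix_vector_right_distrib matrix_vector_mult_scaleR matrix_vector_mul_assoc)
  have EP: "E ** ?P = ?P"
    using mp(2) P(2) by (simp add: E_def matrix_mult_add_rdistrib scalar_matrix_assoc[symmetric]
        outer_product_matrix_mult vP P(3) outer_product_zero_right)
  have ED: "E ** D = D"
    by (simp add: D matrix_add_ldistrib matrix_mult_scaleR matrix_mult_outer_product E1 El EL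
        del: scaleR_minus_left)
  have Eu: "E *v u = u"
    by (simp add: u_def matrix_vector_right_distrib matrix_vector_mult_scaleR E1 Ez)
  have EX: "E ** X = X"
    by (simp add: X_def matrix_add_ldistrib matrix_mult_scaleR matrix_mult_outer_product Eu EP
        del: scaleR_minus_left)
  have "transpose E = E"
    by (simp add: E_def transpose_add transpose_scalar transpose_outer_product mp)
  then have "is_moore_penrose_inverse D X"
    unfolding is_moore_penrose_inverse_def by (simp add: DX XD ED EX)
  then have DX_eq: "moore_penrose_inverse D = X" by (rule moore_penrose_inverse_eqI)
  then show "moore_penrose_inverse D =
      (- (1 / (2 * a * b))) *\<^sub>R ?P + (1 / (2 * m)) *\<^sub>R outer_product u w"
    by (simp add: X_def)
  have u1: "1 \<bullet> u = 2" and w1: "1 \<bullet> w = 2"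
    using n by (simp_all add: u_def w_def inner_add_right z1 one)
  have w1': "w \<bullet> 1 = 2" using w1 by (simp add: inner_commute)
  show X1: "moore_penrose_inverse D *v 1 = (1 / m) *\<^sub>R u"
    by (simp add: DX_eq X_def matrix_vector_mult_add_rdistrib outer_product_vector_mult
        scaleR_matrix_vector_assoc[symmetric] P(3) w1' del: scaleR_minus_left)
  have "1 v* X = transpose X *v 1" by (simp add: transpose_matrix_vector)
  also have "\<dots> = (1 / m) *\<^sub>R w"
    by (simp add: X_def transpose_add transpose_scalar transpose_outer_product P
        matrix_vector_mult_add_rdistrib outer_product_vector_mult
        scaleR_matrix_vector_assoc[symmetric] u1 inner_commute del: scaleR_minus_left)
  finally show "1 v* moore_penrose_inverse D = (1 / m) *\<^sub>R w" by (simp add: DX_eq)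
  show "1 \<bullet> (moore_penrose_inverse D *v 1) = 2 / m"
    by (simp add: X1 u1)
qed

section \<open>Double centring and the centre of the sphere\<close>

text \<open>The difference of the kernels has the form \<open>\<delta> i + \<epsilon> j\<close>. Its
  vanishing row and column sums make both functions constant, with constants that cancel.\<close>

lemma centred_kernel_unique:
  fixes G H :: "'n::finite \<Rightarrow> 'n \<Rightarrow> real"
  assumes eq: "\<And>i j. p i + q j + G i j = p' i + q' j + H i j"
    and G: "\<And>i. (\<Sum>j\<in>UNIV. G i j) = 0" "\<And>j. (\<Sum>i\<in>UNIV. G i j) = 0"
    and H: "\<And>i. (\<Sum>j\<in>UNIV. H i j) = 0" "\<And>j. (\<Sum>i\<in>UNIV. H i j) = 0"
  shows "G i j = H i j"
proof -
  define n where "n = real CARD('n)"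
  define \<delta> where "\<delta> k = p k - p' k" for k
  define \<epsilon> where "\<epsilon> k = q k - q' k" for k
  have n: "n > 0" by (simp add: n_def)
  have d: "H i j - G i j = \<delta> i + \<epsilon> j" for i j
    using eq[of i j] by (simp add: \<delta>_def \<epsilon>_def)
  have r: "n * \<delta> i + sum \<epsilon> UNIV = 0" for i
  proof -
    have "(\<Sum>j\<in>UNIV. H i j - G i j) = n * \<delta> i + sum \<epsilon> UNIV"
      by (simp add: d sum.distrib n_def)
    then show ?thesis by (simp add: sum_subtractf G H)
  qed
  have s: "sum \<delta> UNIV + n * \<epsilon> j = 0" for j
  proof -
    have "(\<Sum>i\<in>UNIV. H i j - G i j) = sum \<delta> UNIV + n * \<epsilon> j"
      by (simp add: d sum.distrib n_def)
    then show ?thesis by (simp add: sum_subtractf G H)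
  qed
  \<comment> \<open>Summing \<open>r\<close> over all rows shows that the totals of \<delta> and
    \<epsilon> cancel; adding \<open>r\<close> and \<open>s\<close> then isolates
    \<open>\<delta> i + \<epsilon> j\<close>.\<close>
  have "(\<Sum>i\<in>(UNIV::'n set). n * \<delta> i + sum \<epsilon> UNIV) = 0" by (simp add: r)
  then have "n * (sum \<delta> UNIV + sum \<epsilon> UNIV) = 0"
    by (simp add: sum.distrib sum_distrib_left[symmetric] n_def distrib_left)
  then have "sum \<delta> UNIV + sum \<epsilon> UNIV = 0" using n by simp
  then have "n * (\<delta> i + \<epsilon> j) = 0" using r[of i] s[of j] by (simp add: algebra_simps)
  then show ?thesis using n d[of i j] by simp
qed

text \<open>Expanding the sphere equation splits the diagonal of \<open>L\<close> into a vector
  \<open>h\<close> in the range of \<open>L\<close> and a multiple of \<open>1\<close>. The inverse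
  of \<open>L\<close> kills \<open>1\<close>, so it maps the diagonal and \<open>h\<close> to the
  same vector.\<close>

lemma circum_gedm_diagonal:
  fixes L :: "real^'n^'n"
  assumes ab: "a > 0" "b > 0" and symL: "transpose L = L" and L1: "L *v 1 = 0"
    and D: "D = (\<chi> i j. a\<^sup>2 * L $ i $ i + b\<^sup>2 * L $ j $ j - 2 * a * b * L $ i $ j)"
    and D0: "D \<noteq> 0"
    and circ: "circum_gedm TYPE('v::euclidean_space) D"
  shows "\<exists>c>0. (\<chi> i. L $ i $ i) =
    L *v (moore_penrose_inverse L *v (\<chi> i. L $ i $ i)) + c *\<^sub>R 1"
proof -
  let ?P = "moore_penrose_inverse L"
  obtain \<alpha> \<beta> and x :: "'n \<Rightarrow> 'v" where pos: "\<alpha> > 0" "\<beta> > 0" and hyp: "on_hypersphere x"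
    and x0: "(\<Sum>i\<in>UNIV. x i) = 0"
    and Dx: "\<And>i j. D $ i $ j = (norm (\<alpha> *\<^sub>R x i - \<beta> *\<^sub>R x j))\<^sup>2"
    using circ unfolding circum_gedm_def by blast
  obtain v r where vr: "\<And>i. (norm (x i - v))\<^sup>2 = r"
    using hyp unfolding on_hypersphere_def by blast
  have row: "(\<Sum>j\<in>UNIV. L $ i $ j) = 0" for i
    using L1 by (simp add: vec_eq_iff matrix_vector_mult_def)
  have sym: "L $ i $ j = L $ j $ i" for i j
    by (subst symL[symmetric]) (simp add: transpose_def)
  have col: "(\<Sum>i\<in>UNIV. L $ i $ j) = 0" for j
    using row[of j] by (simp add: sym[of _ j])
  \<comment> \<open>\<open>D\<close> has one expansion from \<open>L\<close> and one from
    \<open>x\<close>. The diagonal terms depend on one index each, and the mixed terms are centred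
    because \<open>L *v 1 = 0\<close> and the \<open>x i\<close> sum to zero.\<close>
  have LG: "- 2 * a * b * L $ i $ j = - 2 * \<alpha> * \<beta> * (x i \<bullet> x j)" for i j
  proof (rule centred_kernel_unique[where G = "\<lambda>i j. - 2 * a * b * L $ i $ j"
        and H = "\<lambda>i j. - 2 * \<alpha> * \<beta> * (x i \<bullet> x j)"])
    show "a\<^sup>2 * L $ i $ i + b\<^sup>2 * L $ j $ j + - 2 * a * b * L $ i $ j =
        \<alpha>\<^sup>2 * (x i \<bullet> x i) + \<beta>\<^sup>2 * (x j \<bullet> x j) + - 2 * \<alpha> * \<beta> * (x i \<bullet> x j)" for i j
      using Dx[of i j] inner_commute[of "x i" "x j"] unfolding D power2_norm_eq_inner
      by (simp add: inner_diff_left inner_diff_right power2_eq_square algebra_simps)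
  qed (simp_all only: sum_distrib_left[symmetric] row col inner_sum_left[symmetric]
      inner_sum_right[symmetric] x0 inner_zero_left inner_zero_right mult_zero_right)
  define t where "t = \<alpha> * \<beta> / (a * b)"
  have t: "t > 0" using ab pos by (simp add: t_def)
  have Lt: "L $ i $ j = t * (x i \<bullet> x j)" for i j
    using LG[of i j] ab by (simp add: t_def field_simps)
  \<comment> \<open>These come from solving \<open>(norm (x i - v))\<^sup>2 = r\<close> for
    \<open>x i \<bullet> x i\<close> and scaling by \<open>t\<close>.\<close>
  define h :: "real^'n" where "h = (\<chi> i. (2 * t) * (x i \<bullet> v))"
  define c where "c = t * (r - v \<bullet> v)"
  have lh: "(\<chi> i. L $ i $ i) = h + c *\<^sub>R 1"
  proof -
    have "x i \<bullet> x i = 2 * (x i \<bullet> v) + (r - v \<bullet> v)" for i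
      using vr[of i] by (simp add: power2_norm_eq_inner inner_diff_left inner_diff_right inner_commute)
    then show ?thesis by (simp add: vec_eq_iff Lt h_def c_def distrib_left)
  qed
  have Lh: "L *v (?P *v h) = h"
  proof (rule symmetric_range_if_orthogonal_null[OF symL])
    fix e :: "real^'n" assume e: "L *v e = 0"
    \<comment> \<open>A kernel vector of \<open>L\<close> is a linear relation among the
      \<open>x i\<close>: \<open>?y\<close> is orthogonal to every \<open>x i\<close> and lies in
      their span, so it vanishes. The entries of \<open>h\<close> are inner products with the fixed
      vector \<open>v\<close>, so \<open>e \<bullet> h\<close> is a multiple of
      \<open>?y \<bullet> v\<close>.\<close>
    let ?y = "\<Sum>i\<in>UNIV. e $ i *\<^sub>R x i"
    have "t * (x i \<bullet> ?y) = (L *v e) $ i" for i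
      by (simp add: matrix_vector_mult_def Lt inner_sum_right sum_distrib_left mult_ac)
    then have "x i \<bullet> ?y = 0" for i using e t by simp
    then have "?y \<bullet> ?y = 0" by (subst inner_sum_left) simp
    then have "?y = 0" by simp
    moreover have "e \<bullet> h = (2 * t) * (?y \<bullet> v)"
      by (simp add: inner_vec_def h_def inner_sum_left sum_distrib_left mult_ac)
    ultimately show "e \<bullet> h = 0" by simp
  qed
  have "?P *v 1 = 0" by (rule symmetric_moore_penrose_inverse_null[OF symL L1])
  then have "L *v (?P *v (\<chi> i. L $ i $ i)) = h"
    by (simp add: lh matrix_vector_right_distrib matrix_vector_mult_scaleR Lh)
  \<comment> \<open>Take the trace of \<open>L\<close>: \<open>h\<close> contributes nothing since
    the \<open>x i\<close> sum to zero, leaving \<open>c\<close> times the dimension. The trace is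
    positive because \<open>D \<noteq> 0\<close> rules out that all \<open>x i\<close>
    vanish.\<close>
  moreover have "c > 0"
  proof -
    have "\<exists>i. x i \<noteq> 0"
    proof (rule ccontr)
      assume "\<not> (\<exists>i. x i \<noteq> 0)"
      then have "D = 0" using Dx by (simp add: vec_eq_iff)
      then show False using D0 by simp
    qed
    then obtain k where "x k \<noteq> 0" by blast
    then have "0 < (\<Sum>i\<in>UNIV. L $ i $ i)"
      using t by (intro sum_pos2[of _ k]) (auto simp: Lt)
    also have "\<dots> = (\<Sum>i\<in>UNIV. (h + c *\<^sub>R 1) $ i)"
      by (simp add: lh[symmetric])
    also have "\<dots> = (2 * t) * ((\<Sum>i\<in>UNIV. x i) \<bullet> v) + real CARD('n) * c"
      by (simp add: h_def sum.distrib sum_distrib_left inner_sum_left)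
    finally show ?thesis by (simp add: x0 zero_less_mult_iff)
  qed
  ultimately show ?thesis using lh by auto
qed

section \<open>Assembling the formula for the inverse of \<open>D\<close>\<close>

theorem theorem2p19:
  fixes a b :: real and L D :: "real^'n^'n"
  assumes "a > 0" and "b > 0"
    and "generalized_laplacian L"
    and "D = (\<chi> i j. a\<^sup>2 * L $ i $ i + b\<^sup>2 * L $ j $ j - 2 * a * b * L $ i $ j)"
    and "D \<noteq> 0"
    and "circum_gedm TYPE('v::euclidean_space) D"
  shows "1 \<bullet> (moore_penrose_inverse D *v 1) \<noteq> 0 \<and>
    moore_penrose_inverse D =
      - (1 / (2 * a * b)) *\<^sub>R moore_penrose_inverse L +
      (1 / (1 \<bullet> (moore_penrose_inverse D *v 1))) *\<^sub>R
        outer_product (moore_penrose_inverse D *v 1) (1 v* moore_penrose_inverse D)"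
proof -
  have L: "transpose L = L" "L *v 1 = 0" and psd: "\<And>x. 0 \<le> x \<bullet> (L *v x)"
    using assms(3) by (auto simp: generalized_laplacian_def positive_semidefinite_def)
  define l where "l = (\<chi> i. L $ i $ i)"
  define z where "z = moore_penrose_inverse L *v l"
  obtain c where c: "c > 0" and l: "l = L *v z + c *\<^sub>R 1"
    using circum_gedm_diagonal[OF assms(1,2) L assms(4-6)] unfolding l_def z_def by blast
  define m where "m = 2 * (a\<^sup>2 + b\<^sup>2) * c + a * b * (z \<bullet> (L *v z))"
  \<comment> \<open>The first summand is positive by \<open>c > 0\<close>, the second nonnegative
    because \<open>L\<close> is positive semidefinite.\<close>
  have m: "m > 0" unfolding m_def
    using assms(1,2) c psd[of z] by (intro add_pos_nonneg mult_pos_pos mult_nonneg_nonneg) auto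
  then have m0: "m \<noteq> 0" by simp
  have D: "D = a\<^sup>2 *\<^sub>R outer_product l 1 + b\<^sup>2 *\<^sub>R outer_product 1 l + (- 2 * a * b) *\<^sub>R L"
    by (simp add: assms(4) l_def outer_product_def vec_eq_iff)
  note X = moore_penrose_inverse_circum[OF assms(1,2) L z_def l D m_def m0]
  show ?thesis
    \<comment> \<open>\<open>X(4)\<close> is rewritten first because its left side contains that of
      \<open>X(2)\<close>. The scalars agree: \<open>m / 2\<close> times \<open>1 / m\<close> twice
      is \<open>1 / (2 * m)\<close>.\<close>
    unfolding X(4) unfolding X(2,3) using X(1) m0
    by (simp add: outer_product_scaleR_left outer_product_scaleR_right)
qed

end
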